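(* Let $\kappa\in\mathbb{R}$ and $p_1,p_2,p_3,p_4\in M_\kappa^2$, and let $d_{ij}:=d_{M_\kappa^2}(p_i,p_j)$. Then $$s_\kappa(d_{13}/2)\,s_\kappa(d_{24}/2)\le s_\kappa(d_{12}/2)\,s_\kappa(d_{34}/2)+s_\kappa(d_{23}/2)\,s_\kappa(d_{41}/2).$$
   Context: For $x,y\in\mathbb{R}^{3}$ let $\langle x,y\rangle=x_0y_0+x_1y_1+x_2y_2$ and $\langle x|y\rangle=-x_0y_0+x_1y_1+x_2y_2$. The model plane of constant curvature $\kappa$ is $M_\kappa^2=\{x\in\mathbb{R}^{3}:\langle x,x\rangle=1/\kappa\}$ with distance $d_{M_\kappa^2}(x,y)=\frac{1}{\sqrt{\kappa}}\arccos(\kappa\langle x,y\rangle)$ if $\kappa>0$; $M_0^2=\mathbb{R}^2$ with the Euclidean distance; and $M_\kappa^2=\{x\in\mathbb{R}^{3}:\langle x|x\rangle=1/\kappa,\ x_0>0\}$ with distance $d_{M_\kappa^2}(x,y)=\frac{1}{\sqrt{-\kappa}}\operatorname{arcosh}(\kappa\langle x|y\rangle)$ if $\kappa<0$. The function $s_\kappa:[0,\infty)\to\mathbb{R}$ is defined by $s_\kappa(t)=\frac{1}{\sqrt{\kappa}}\sin(\sqrt{\kappa}\,t)$ if $\kappa>0$, $s_0(t)=t$, and $s_\kappa(t)=\frac{1}{\sqrt{-\kappa}}\sinh(\sqrt{-\kappa}\,t)$ if $\kappa<0$. *)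

theory Defs
  imports "HOL-Analysis.Analysis"
begin

text \<open>
  Coordinates of \<^typ>\<open>real^3\<close> are indexed by \<open>0, 1, 2\<close>, the three elements of the index
  type (in which \<open>3 = 0\<close>).
\<close>

lemma inner_real3: "x \<bullet> y = x$0 * y$0 + x$1 * y$1 + x$2 * y$2" for x y :: "real^3"
proof -
  have "(3::3) = 0" by simp
  then have "x$3 = x$0" "y$3 = y$0" by (rule arg_cong)+
  then show ?thesis by (simp add: inner_vec_def sum_3)
qed

definition lorentz :: "real^3 \<Rightarrow> real^3 \<Rightarrow> real"
  where "lorentz x y = - (x$0 * y$0) + x$1 * y$1 + x$2 * y$2"

text \<open>
  The flat plane lives in \<^typ>\<open>real^2\<close> and the curved ones in \<^typ>\<open>real^3\<close>; a sum type accommodates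
  both, so that the curvature can be an ordinary variable.
\<close>

type_synonym model_point = "real^2 + real^3"

definition model_plane :: "real \<Rightarrow> model_point set"
  where "model_plane \<kappa> =
    (if \<kappa> > 0 then Inr ` {x. x \<bullet> x = 1 / \<kappa>}
     else if \<kappa> = 0 then Inl ` UNIV
     else Inr ` {x. lorentz x x = 1 / \<kappa> \<and> x$0 > 0})"

text \<open>Only meaningful for two points of \<^term>\<open>model_plane \<kappa>\<close>, where the projections are defined.\<close>

definition model_dist :: "real \<Rightarrow> model_point \<Rightarrow> model_point \<Rightarrow> real"
  where "model_dist \<kappa> p q =
    (if \<kappa> > 0 then 1 / sqrt \<kappa> * arccos (\<kappa> * (projr p \<bullet> projr q))
     else if \<kappa> = 0 then dist (projl p) (projl q)
     else 1 / sqrt (- \<kappa>) * arcosh (\<kappa> * lorentz (projr p) (projr q)))"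

text \<open>Intended for \<open>t \<ge> 0\<close>; the formulas are used unchanged for negative \<open>t\<close>.\<close>

definition s_fun :: "real \<Rightarrow> real \<Rightarrow> real"
  where "s_fun \<kappa> t =
    (if \<kappa> > 0 then 1 / sqrt \<kappa> * sin (sqrt \<kappa> * t)
     else if \<kappa> = 0 then t
     else 1 / sqrt (- \<kappa>) * sinh (sqrt (- \<kappa>) * t))"

end

theory Submission
  imports Defs
begin

text \<open>
  Up to a constant, \<open>s\<^sub>\<kappa> (d / 2)\<close> is the chordal distance of the ambient quadratic form. For
  \<open>\<kappa> > 0\<close> this is a Euclidean distance. For \<open>\<kappa> < 0\<close>, passing to the upper half-plane turns it
  into a Euclidean distance multiplied by one positive weight for each of the two points. Every term
  of the inequality contains each point exactly once, so the weights cancel and Ptolemy's inequality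
  in a Euclidean space remains; that one follows from the triangle inequality after inversion.
\<close>

text \<open>The distance of the inverted points, with denominators cleared.\<close>

lemma norm_inversion_diff:
  fixes a b :: "'a::real_inner"
  shows "norm ((norm b)\<^sup>2 *\<^sub>R a - (norm a)\<^sup>2 *\<^sub>R b) = norm a * norm b * norm (a - b)"
proof (rule power2_eq_imp_eq)
  have "(norm ((norm b)\<^sup>2 *\<^sub>R a - (norm a)\<^sup>2 *\<^sub>R b))\<^sup>2 = (a \<bullet> a) * (b \<bullet> b) * ((a - b) \<bullet> (a - b))"
    by (simp add: power2_norm_eq_inner inner_diff_left inner_diff_right inner_commute algebra_simps)
  then show "(norm ((norm b)\<^sup>2 *\<^sub>R a - (norm a)\<^sup>2 *\<^sub>R b))\<^sup>2 = (norm a * norm b * norm (a - b))\<^sup>2"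
    by (simp add: power_mult_distrib flip: power2_norm_eq_inner)
qed simp_all

text \<open>For nonzero vectors, dividing by |a||b||c| leaves the triangle inequality for the
  inverted points a/|a|^2, b/|b|^2, c/|c|^2. This is Ptolemy with the fourth point at the
  origin.\<close>

lemma ptolemy_norm:
  fixes a b c :: "'a::real_inner"
  shows "norm (a - c) * norm b \<le> norm (a - b) * norm c + norm (b - c) * norm a"
proof (cases "a = 0 \<or> b = 0 \<or> c = 0")
  case True
  then show ?thesis by (auto simp: mult.commute)
next
  case False
  then have pos: "norm a * norm b * norm c > 0" by simp
  have "(norm b)\<^sup>2 *\<^sub>R ((norm c)\<^sup>2 *\<^sub>R a - (norm a)\<^sup>2 *\<^sub>R c)
      = (norm c)\<^sup>2 *\<^sub>R ((norm b)\<^sup>2 *\<^sub>R a - (norm a)\<^sup>2 *\<^sub>R b)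
        + (norm a)\<^sup>2 *\<^sub>R ((norm c)\<^sup>2 *\<^sub>R b - (norm b)\<^sup>2 *\<^sub>R c)"
    by (simp add: scaleR_diff_right mult.commute)
  from arg_cong[OF this, of norm]
  have "(norm b)\<^sup>2 * norm ((norm c)\<^sup>2 *\<^sub>R a - (norm a)\<^sup>2 *\<^sub>R c)
      \<le> (norm c)\<^sup>2 * norm ((norm b)\<^sup>2 *\<^sub>R a - (norm a)\<^sup>2 *\<^sub>R b)
        + (norm a)\<^sup>2 * norm ((norm c)\<^sup>2 *\<^sub>R b - (norm b)\<^sup>2 *\<^sub>R c)"
    by (metis norm_triangle_ineq norm_scaleR abs_power2)
  then have "(norm a * norm b * norm c) * (norm (a - c) * norm b)
      \<le> (norm a * norm b * norm c) * (norm (a - b) * norm c + norm (b - c) * norm a)"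
    unfolding norm_inversion_diff by (simp add: power2_eq_square algebra_simps)
  then show ?thesis using pos by (simp only: mult_le_cancel_left_pos)
qed

lemma ptolemy_dist:
  fixes p q r s :: "'a::real_inner"
  shows "dist p r * dist q s \<le> dist p q * dist r s + dist q r * dist s p"
  \<comment> \<open>Translation moves \<open>s\<close> to the origin; \<open>of\<close> fills
    \<open>a\<close>, \<open>c\<close>, \<open>b\<close>, their order of occurrence.\<close>
  using ptolemy_norm[of "p - s" "r - s" "q - s"]
  by (simp add: dist_norm norm_minus_commute[of s p])

text \<open>Each of the three products acquires the same factor
  \<open>w p * w q * w r * w s\<close>. All signs of the curvature are reduced to this form.\<close>

lemma ptolemy_weighted:
  fixes u :: "'b \<Rightarrow> 'a::real_inner" and w :: "'b \<Rightarrow> real"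
  assumes f: "\<And>x y. x \<in> S \<Longrightarrow> y \<in> S \<Longrightarrow> f x y = w x * w y * dist (u x) (u y)"
    and w: "\<And>x. x \<in> S \<Longrightarrow> w x \<ge> 0"
    and S: "p \<in> S" "q \<in> S" "r \<in> S" "s \<in> S"
  shows "f p r * f q s \<le> f p q * f r s + f q r * f s p"
proof -
  have "w p * w q * w r * w s \<ge> 0" using w S by simp
  from mult_left_mono[OF ptolemy_dist[of "u p" "u r" "u q" "u s"] this]
  show ?thesis using S by (simp add: f algebra_simps)
qed

text \<open>Half-angle formula; the nonnegative root is right because \<open>arccos c / 2\<close>
  lies between 0 and pi/2.\<close>

lemma sin_half_arccos:
  assumes "\<bar>c\<bar> \<le> 1"
  shows "sin (arccos c / 2) = sqrt ((1 - c) / 2)"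
proof (rule real_sqrt_unique[symmetric])
  have "c = cos (2 * (arccos c / 2))" using assms by (simp add: cos_arccos_abs)
  then show "(sin (arccos c / 2))\<^sup>2 = (1 - c) / 2" unfolding cos_double_sin by simp
  show "0 \<le> sin (arccos c / 2)"
    using arccos_lbound[of c] arccos_ubound[of c] assms pi_gt_zero
    by (intro sin_ge_zero) (simp_all add: abs_le_iff)
qed

lemma sinh_half_arcosh:
  fixes c :: real
  assumes "c \<ge> 1"
  shows "sinh (arcosh c / 2) = sqrt ((c - 1) / 2)"
proof (rule real_sqrt_unique[symmetric])
  have "c = cosh (2 * (arcosh c / 2))" using assms by (simp add: cosh_arcosh_real)
  also have "\<dots> = 2 * (sinh (arcosh c / 2))\<^sup>2 + 1"
    unfolding cosh_double_cosh by (simp add: cosh_square_eq)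
  finally show "(sinh (arcosh c / 2))\<^sup>2 = (c - 1) / 2" by simp
  show "0 \<le> sinh (arcosh c / 2)" using assms by simp
qed

text \<open>On a sphere of radius R, a central angle \<theta> spans a chord of length 2 R
  sin(\<theta>/2); here R = 1/sqrt \<kappa> and \<theta> = sqrt \<kappa> times the distance.\<close>

lemma s_fun_half_dist_sphere:
  assumes k: "\<kappa> > 0" and x: "x \<bullet> x = 1 / \<kappa>" and y: "y \<bullet> y = 1 / \<kappa>"
  shows "s_fun \<kappa> (model_dist \<kappa> (Inr x) (Inr y) / 2) = dist x y / 2"
proof -
  have d: "(dist x y)\<^sup>2 = 2 / \<kappa> - 2 * (x \<bullet> y)"
    unfolding dist_norm power2_norm_eq_inner using x y
    by (simp add: inner_diff_left inner_diff_right inner_commute)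
  \<comment> \<open>Cauchy-Schwarz puts the argument of \<open>arccos\<close> into [-1, 1].\<close>
  have "\<bar>x \<bullet> y\<bar> \<le> 1 / \<kappa>"
    using Cauchy_Schwarz_ineq2[of x y] x y k
    by (simp add: norm_eq_sqrt_inner real_sqrt_divide)
  then have "\<bar>\<kappa> * (x \<bullet> y)\<bar> \<le> 1" using k by (simp add: abs_mult field_simps)
  then have "s_fun \<kappa> (model_dist \<kappa> (Inr x) (Inr y) / 2) = sqrt ((1 - \<kappa> * (x \<bullet> y)) / 2 / \<kappa>)"
    using k sin_half_arccos[of "\<kappa> * (x \<bullet> y)"]
    by (simp add: s_fun_def model_dist_def real_sqrt_divide real_sqrt_mult)
  also have "(1 - \<kappa> * (x \<bullet> y)) / 2 / \<kappa> = (dist x y / 2)\<^sup>2"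
    using k by (simp add: d power_divide field_simps)
  finally show ?thesis by simp
qed

text \<open>
  The upper half-plane model in the light-cone coordinates \<open>x\<^sub>0 \<plusminus> x\<^sub>1\<close>.
\<close>

definition half_plane :: "real \<Rightarrow> real^3 \<Rightarrow> complex"
  where "half_plane r x = Complex (x$2 / (x$0 - x$1)) (r / (x$0 - x$1))"

lemma hyperboloid_light_cone_pos:
  assumes "lorentz x x < 0" "x$0 > 0"
  shows "x$0 - x$1 > 0"
proof -
  have "(x$1)\<^sup>2 < (x$0)\<^sup>2"
    using assms(1) zero_le_power2[of "x$2"] unfolding lorentz_def power2_eq_square by linarith
  then show ?thesis using assms(2) power2_less_imp_less[of "x$1" "x$0"] by simp
qed

text \<open>The right-hand side is \<open>lorentz (x - y) (x - y)\<close>, the squared Lorentzian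
  chord. For r > 0 this is the classical cosh d = 1 + |z - w|^2 / (2 Im z Im w), as the imaginary
  parts are r divided by the light-cone coordinates.\<close>

lemma dist_half_plane:
  assumes x: "lorentz x x = - r\<^sup>2" "x$0 - x$1 > 0" and y: "lorentz y y = - r\<^sup>2" "y$0 - y$1 > 0"
  shows "(x$0 - x$1) * (y$0 - y$1) * (dist (half_plane r x) (half_plane r y))\<^sup>2
    = - 2 * r\<^sup>2 - 2 * lorentz x y"
proof -
  define a a' where "a = x$0 - x$1" and "a' = y$0 - y$1"
  have a: "a > 0" "a' > 0" using x y by (simp_all add: a_def a'_def)
  \<comment> \<open>The hyperboloid equation in light-cone coordinates; it will cancel the
    denominators \<open>a\<close> and \<open>a'\<close>.\<close>
  have b: "(x$2)\<^sup>2 + r\<^sup>2 = a * (x$0 + x$1)" "(y$2)\<^sup>2 + r\<^sup>2 = a' * (y$0 + y$1)"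
    using x(1) y(1) by (simp_all add: lorentz_def a_def a'_def algebra_simps power2_eq_square)
  have "a * a' * (dist (half_plane r x) (half_plane r y))\<^sup>2
      = a * a' * ((x$2 / a - y$2 / a')\<^sup>2 + (r / a - r / a')\<^sup>2)"
    by (simp add: half_plane_def dist_norm cmod_power2 a_def a'_def)
  also have "\<dots> = a' * ((x$2)\<^sup>2 + r\<^sup>2) / a + a * ((y$2)\<^sup>2 + r\<^sup>2) / a' - 2 * (x$2 * y$2) - 2 * r\<^sup>2"
    using a by (simp add: field_simps power2_eq_square)
  also have "\<dots> = a' * (x$0 + x$1) + a * (y$0 + y$1) - 2 * (x$2 * y$2) - 2 * r\<^sup>2"
    unfolding b using a by simp
  also have "\<dots> = - 2 * r\<^sup>2 - 2 * lorentz x y"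
    by (simp add: lorentz_def a_def a'_def algebra_simps)
  finally show ?thesis by (simp add: a_def a'_def)
qed

lemma s_fun_half_dist_hyperboloid:
  assumes k: "\<kappa> < 0"
    and x: "lorentz x x = 1 / \<kappa>" "x$0 > 0" and y: "lorentz y y = 1 / \<kappa>" "y$0 > 0"
  defines "u \<equiv> half_plane (1 / sqrt (- \<kappa>))"
  shows "s_fun \<kappa> (model_dist \<kappa> (Inr x) (Inr y) / 2)
    = sqrt ((x$0 - x$1) / 2) * sqrt ((y$0 - y$1) / 2) * dist (u x) (u y)"
proof -
  have r: "1 / \<kappa> = - (1 / sqrt (- \<kappa>))\<^sup>2" using k by (simp add: power_divide)
  have ax: "x$0 - x$1 > 0" and ay: "y$0 - y$1 > 0"
    using k x y by (simp_all only: hyperboloid_light_cone_pos divide_less_0_1_iff)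
  define D where "D = (x$0 - x$1) * (y$0 - y$1) * (dist (u x) (u y))\<^sup>2"
  have D: "D = 2 / \<kappa> - 2 * lorentz x y"
    using dist_half_plane[of x "1 / sqrt (- \<kappa>)" y] x y r ax ay by (simp add: D_def u_def)
  have "D \<ge> 0" using ax ay by (simp add: D_def)
  have c: "\<kappa> * lorentz x y - 1 = - \<kappa> * D / 2" using k unfolding D by (simp add: field_simps)
  \<comment> \<open>The squared chord \<open>D\<close> is nonnegative as a weighted Euclidean
    square. This gives the reversed Cauchy-Schwarz inequality that puts the argument of
    \<open>arcosh\<close> into its domain.\<close>
  have "- \<kappa> * D / 2 \<ge> 0" using k \<open>D \<ge> 0\<close> by (simp add: mult_nonpos_nonneg)
  then have "\<kappa> * lorentz x y \<ge> 1" using c by linarith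
  then have "s_fun \<kappa> (model_dist \<kappa> (Inr x) (Inr y) / 2)
      = sqrt ((\<kappa> * lorentz x y - 1) / 2) / sqrt (- \<kappa>)"
    using k sinh_half_arcosh[of "\<kappa> * lorentz x y"] by (simp add: s_fun_def model_dist_def)
  also have "\<dots> = sqrt (D / 4)"
    unfolding c using k by (simp flip: real_sqrt_divide)
  also have "\<dots> = sqrt ((x$0 - x$1) / 2 * ((y$0 - y$1) / 2) * (dist (u x) (u y))\<^sup>2)"
    by (simp add: D_def)
  finally show ?thesis by (simp only: real_sqrt_mult real_sqrt_abs abs_of_nonneg zero_le_dist)
qed

theorem corollary1:
  fixes \<kappa> :: real and p1 p2 p3 p4 :: model_point
  assumes "p1 \<in> model_plane \<kappa>" "p2 \<in> model_plane \<kappa>" "p3 \<in> model_plane \<kappa>" "p4 \<in> model_plane \<kappa>"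
  shows "s_fun \<kappa> (model_dist \<kappa> p1 p3 / 2) * s_fun \<kappa> (model_dist \<kappa> p2 p4 / 2)
    \<le> s_fun \<kappa> (model_dist \<kappa> p1 p2 / 2) * s_fun \<kappa> (model_dist \<kappa> p3 p4 / 2)
      + s_fun \<kappa> (model_dist \<kappa> p2 p3 / 2) * s_fun \<kappa> (model_dist \<kappa> p4 p1 / 2)"
proof -
  let ?f = "\<lambda>p q. s_fun \<kappa> (model_dist \<kappa> p q / 2)"
  consider "\<kappa> > 0" | "\<kappa> = 0" | "\<kappa> < 0" by linarith
  then show ?thesis
  proof cases
    case 1
    \<comment> \<open>The factor 1/2 of half the chord is split into equal constant weights for the
      two points.\<close>
    have "?f p q = sqrt (1 / 2) * sqrt (1 / 2) * dist (projr p) (projr q)"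
      if "p \<in> model_plane \<kappa>" "q \<in> model_plane \<kappa>" for p q
      using 1 that by (auto simp: model_plane_def s_fun_half_dist_sphere)
    then show ?thesis by (rule ptolemy_weighted[where f = ?f]) (use assms in auto)
  next
    case 2
    have "?f p q = sqrt (1 / 2) * sqrt (1 / 2) * dist (projl p) (projl q)" for p q
      using 2 by (simp add: s_fun_def model_dist_def)
    then show ?thesis by (rule ptolemy_weighted[where f = ?f]) (use assms in auto)
  next
    case 3
    define w where "w p = sqrt ((projr p $ 0 - projr p $ 1) / 2)" for p :: model_point
    define u where "u p = half_plane (1 / sqrt (- \<kappa>)) (projr p)" for p :: model_point
    have "?f p q = w p * w q * dist (u p) (u q)"
      if "p \<in> model_plane \<kappa>" "q \<in> model_plane \<kappa>" for p q
      using 3 that by (auto simp: model_plane_def s_fun_half_dist_hyperboloid w_def u_def)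
    moreover have "w p \<ge> 0" if "p \<in> model_plane \<kappa>" for p
      using 3 that hyperboloid_light_cone_pos[of "projr p"]
      by (auto simp: model_plane_def w_def less_imp_le)
    ultimately show ?thesis using assms by (rule ptolemy_weighted[where f = ?f])
  qed
qed

end
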